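(* Let $p\le q$ and let $\mathbf G\in\mathbb R^{p\times q}$ have rank $r\ge 1$ and compact SVD $\mathbf G=\mathbf U\Sigma\mathbf V^\top$ with $\Sigma=\operatorname{diag}(\sigma_1,\dots,\sigma_r)$, $\sigma_1\ge\cdots\ge\sigma_r>0$. Let $a,b,c\in\mathbb R$, put $\phi(s):=as+bs^3+cs^5$ and $\pi(t):=a+bt+ct^2$, and assume $a>1$ and $0<\pi(t)\le a$ for all $t\in[0,1]$. Define $$\mathbf X_0=\frac{\mathbf G}{\|\mathbf G\|_F},\qquad \mathbf X_{k+1}=\bigl(a\mathbf I_p+b\,\mathbf X_k\mathbf X_k^\top+c(\mathbf X_k\mathbf X_k^\top)^2\bigr)\mathbf X_k\quad(k\ge 0).$$ Then for every $k\ge0$, $$\mathbf X_k=\mathbf U\operatorname{diag}\bigl(s_1^{(k)},\dots,s_r^{(k)}\bigr)\mathbf V^\top,\qquad s_i^{(0)}=\frac{\sigma_i}{\|\mathbf G\|_F},\qquad s_i^{(k+1)}=\phi\bigl(s_i^{(k)}\bigr),$$ and $$\frac1{\sqrt r}\bigl\|\mathbf X_k-\operatorname{Orth}(\mathbf G)\bigr\|_F\ \ge\ \frac1{\sqrt r}\left(\sum_{i=1}^r\left(1-\frac{a^k}{\kappa_i\sqrt{\operatorname{sr}(\mathbf G)}}\right)_+^2\right)^{1/2}.$$ Moreover, the exit time $\tau_i:=\log_a(\|\mathbf G\|_F/\sigma_i)$ of the $i$-th singular direction from the linear regime (the real number $k$ at which $a^k\sigma_i/\|\mathbf G\|_F=1$)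 equals $\tau_i=\log_a\bigl(\kappa_i\sqrt{\operatorname{sr}(\mathbf G)}\bigr)$ for each $i$; in particular $\tau_1=\log_a\sqrt{\operatorname{sr}(\mathbf G)}$, $\tau_r=\log_a\bigl(\kappa(\mathbf G)\sqrt{\operatorname{sr}(\mathbf G)}\bigr)$, and $\tau_r-\tau_1=\log_a\kappa(\mathbf G)$.
   Context: For a matrix $\mathbf G$ of rank $r$ with compact SVD $\mathbf G=\mathbf U\Sigma\mathbf V^\top$ (with $\mathbf U,\mathbf V$ having $r$ orthonormal columns): $\operatorname{Orth}(\mathbf G):=\mathbf U\mathbf V^\top$ (polar factor); $\operatorname{sr}(\mathbf G):=\|\mathbf G\|_F^2/\|\mathbf G\|_2^2$ (stable rank), where $\|\cdot\|_F$ is the Frobenius norm and $\|\cdot\|_2$ the operator norm; $\kappa_i:=\sigma_1/\sigma_i$; $\kappa(\mathbf G):=\sigma_1/\sigma_r$. For real $x$, $(x)_+:=\max\{x,0\}$. *)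

theory Defs
  imports "HOL-Analysis.Analysis"
begin

definition diag_mat :: "('r \<Rightarrow> real) \<Rightarrow> real^'r^'r" where
  "diag_mat d = (\<chi> i j. if i = j then d i else 0)"

(* The r columns of U and V are indexed by a finite linearly ordered type 'r with
   CARD('r) = rank G; its least and greatest elements play the roles of the indices 1 and r.
   Since types are nonempty, rank G \<ge> 1 is implied. *)
definition compact_svd ::
  "real^'q^'p \<Rightarrow> real^'r::{finite,linorder}^'p \<Rightarrow> ('r \<Rightarrow> real) \<Rightarrow>
   real^'r::{finite,linorder}^'q \<Rightarrow> bool" where
  "compact_svd G U \<sigma> V \<longleftrightarrow>
     rank G = CARD('r) \<and>
     transpose U ** U = mat 1 \<and> transpose V ** V = mat 1 \<and>
     antimono \<sigma> \<and> (\<forall>i. 0 < \<sigma> i) \<and>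
     G = U ** diag_mat \<sigma> ** transpose V"

abbreviation first_index :: "'r::{finite,linorder}" where
  "first_index \<equiv> Min UNIV"

abbreviation last_index :: "'r::{finite,linorder}" where
  "last_index \<equiv> Max UNIV"

(* Orth(G) and kappa(G) depend on G only, not on the compact SVD chosen, hence the definite
   descriptions. The type token only supplies the column index type, which cannot be
   quantified over inside a definition. *)
definition Orth :: "'r::{finite,linorder} itself \<Rightarrow> real^'q^'p \<Rightarrow> real^'q^'p" where
  "Orth _ G = (THE Q. \<exists>(U::real^'r::{finite,linorder}^'p) \<sigma> (V::real^'r::{finite,linorder}^'q).
     compact_svd G U \<sigma> V \<and> Q = U ** transpose V)"

definition condition_number :: "'r::{finite,linorder} itself \<Rightarrow> real^'q^'p \<Rightarrow> real" where
  "condition_number _ G = (THE \<kappa>. \<exists>(U::real^'r::{finite,linorder}^'p) \<sigma> (V::real^'r::{finite,linorder}^'q).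
     compact_svd G U \<sigma> V \<and> \<kappa> = \<sigma> first_index / \<sigma> last_index)"

definition kappa :: "('r::{finite,linorder} \<Rightarrow> real) \<Rightarrow> 'r \<Rightarrow> real" where
  "kappa \<sigma> i = \<sigma> first_index / \<sigma> i"

(* On real^'q^'p the library norm is the Frobenius norm (the L2 norm of the L2 norms of the
   rows); the operator norm is onorm of the associated linear map. *)
definition stable_rank :: "real^'q^'p \<Rightarrow> real" where
  "stable_rank G = (norm G)\<^sup>2 / (onorm ((*v) G))\<^sup>2"

definition phi :: "real \<Rightarrow> real \<Rightarrow> real \<Rightarrow> real \<Rightarrow> real" where
  "phi a b c s = a * s + b * s ^ 3 + c * s ^ 5"

definition pi_poly :: "real \<Rightarrow> real \<Rightarrow> real \<Rightarrow> real \<Rightarrow> real" where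
  "pi_poly a b c t = a + b * t + c * t\<^sup>2"

primrec iterate :: "real \<Rightarrow> real \<Rightarrow> real \<Rightarrow> real^'q^'p \<Rightarrow> nat \<Rightarrow> real^'q^'p" where
  "iterate a b c G 0 = (1 / norm G) *\<^sub>R G"
| "iterate a b c G (Suc k) =
     (let X = iterate a b c G k; S = X ** transpose X
      in (a *\<^sub>R mat 1 + b *\<^sub>R S + c *\<^sub>R (S ** S)) ** X)"

definition exit_time :: "real \<Rightarrow> real^'q^'p \<Rightarrow> ('r \<Rightarrow> real) \<Rightarrow> 'r \<Rightarrow> real" where
  "exit_time a G \<sigma> i = log a (norm G / \<sigma> i)"

end

theory Submission
  imports Defs
begin

text \<open>
  The polar factor is unique because it is the only matrix $Q = U' V'^{\top}$, over all compact
  singular value decompositions, at which the Frobenius pairing with $G$ attains the sum of the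
  singular values: the pairing is $\sum_i \sigma_i \langle u_i, Q v_i\rangle$, and equality in
  Cauchy--Schwarz forces $Q v_i = u_i$. The iteration acts on the singular values alone, and
  $\phi(s) = s\,\pi(s^2) \le a s$ on $[0,1]$. A singular value may leave $[0,1]$, where $\pi$ is no
  longer controlled, but by then $a^k \sigma_i / \|G\|_F \ge 1$ and its term in the lower bound
  vanishes for good.
\<close>

section \<open>Frobenius norm and matrices with orthonormal columns\<close>

lemma norm_transpose:
  fixes A :: "real^'n^'m"
  shows "norm (transpose A) = norm A"
  by (simp add: norm_eq_sqrt_inner inner_vec_def transpose_def)
     (subst sum.swap, simp)

lemma inner_matrix_vector_transpose:
  fixes A :: "real^'n^'m"
  shows "(A *v x) \<bullet> y = x \<bullet> (transpose A *v y)"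
  by (metis dot_lmul_matrix inner_commute transpose_matrix_vector)

lemma inner_orthonormal_columns:
  fixes U :: "real^'n^'m"
  assumes "transpose U ** U = mat 1"
  shows "(U *v x) \<bullet> (U *v y) = x \<bullet> y"
  by (simp add: inner_matrix_vector_transpose matrix_vector_mul_assoc assms)

lemma norm_orthonormal_columns:
  fixes U :: "real^'n^'m"
  assumes "transpose U ** U = mat 1"
  shows "norm (U *v x) = norm x"
  by (simp add: norm_eq_sqrt_inner inner_orthonormal_columns[OF assms])

text \<open>Since \<open>U\<close> is an isometry, Cauchy--Schwarz for
  \<open>U *v (transpose U *v x)\<close> against \<open>x\<close> bounds the square of the left side
  by itself times \<open>norm x\<close>; one factor cancels unless it is zero.\<close>

lemma norm_transpose_orthonormal_columns_le:
  fixes U :: "real^'n^'m"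
  assumes "transpose U ** U = mat 1"
  shows "norm (transpose U *v x) \<le> norm x"
proof -
  have "(norm (transpose U *v x))\<^sup>2 = (U *v (transpose U *v x)) \<bullet> x"
    by (simp add: inner_matrix_vector_transpose power2_norm_eq_inner)
  also have "\<dots> \<le> norm (transpose U *v x) * norm x"
    using norm_cauchy_schwarz[of "U *v (transpose U *v x)" x]
    by (simp add: norm_orthonormal_columns[OF assms])
  finally show ?thesis
    by (cases "norm (transpose U *v x) = 0") (simp_all add: power2_eq_square)
qed

lemma column_eq_mult_axis: "column k A = (A :: real^'n^'m) *v axis k 1"
  by (simp add: matrix_vector_mult_basis)

lemma norm_column_orthonormal:
  fixes U :: "real^'n^'m"
  assumes "transpose U ** U = mat 1"
  shows "norm (column k U) = 1"
  by (simp only: column_eq_mult_axis norm_orthonormal_columns[OF assms] norm_axis_1)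

text \<open>Left multiplication applies the isometry \<open>U\<close> to each column of
  \<open>A\<close>. The norm groups entries by rows, so the argument passes to transposes.\<close>

lemma norm_matrix_mult_orthonormal_columns:
  fixes U :: "real^'n^'m" and A :: "real^'k^'n"
  assumes "transpose U ** U = mat 1"
  shows "norm (U ** A) = norm A"
proof -
  have row: "transpose (U ** A) $ j = U *v (transpose A $ j)" for j
    by (simp add: vec_eq_iff transpose_def matrix_matrix_mult_def matrix_vector_mult_def)
  have "norm (transpose (U ** A)) = norm (transpose A)"
    unfolding norm_vec_def[of "transpose (U ** A)"] norm_vec_def[of "transpose A"]
    by (simp add: row norm_orthonormal_columns[OF assms])
  then show ?thesis
    by (simp add: norm_transpose)
qed

section \<open>Diagonal matrices between orthonormal factors\<close>

lemma diag_mat_mult_vector: "diag_mat d *v x = (\<chi> i. d i * x $ i)"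
  by (simp add: vec_eq_iff diag_mat_def matrix_vector_mult_def mult_delta_left)

lemma diag_mat_mult: "diag_mat d ** diag_mat e = diag_mat (\<lambda>i. d i * e i)"
proof -
  have "(\<Sum>k\<in>UNIV. (if i = k then d i else 0) * (if k = j then e k else 0))
      = (\<Sum>k\<in>UNIV. if k = i then (if i = j then d i * e i else 0) else 0)" for i j
    by (rule sum.cong) auto
  then show ?thesis
    by (simp add: vec_eq_iff diag_mat_def matrix_matrix_mult_def)
qed

lemma transpose_diag_mat: "transpose (diag_mat d) = diag_mat d"
  by (auto simp: vec_eq_iff transpose_def diag_mat_def)

lemma diag_mat_1: "diag_mat (\<lambda>i. 1) = mat 1"
  by (simp add: vec_eq_iff diag_mat_def mat_def)

lemma norm_diag_mat: "norm (diag_mat d) = sqrt (\<Sum>i\<in>UNIV. (d i)\<^sup>2)"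
  by (simp add: norm_eq_sqrt_inner inner_vec_def diag_mat_def power2_eq_square if_distribR
      if_distrib cong: if_cong)

text \<open>Makes linearity in \<open>d\<close> visible: sums and scalar multiples of such products
  are computed later by comparing entries.\<close>

lemma diag_sandwich_entry:
  fixes U :: "real^'r^'p" and V :: "real^'r^'q"
  shows "(U ** diag_mat d ** transpose V) $ i $ j = (\<Sum>k\<in>UNIV. d k * U $ i $ k * V $ j $ k)"
  by (simp add: matrix_matrix_mult_def transpose_def diag_mat_def if_distrib if_distribR mult.commute
      cong: if_cong)

text \<open>Orthonormal columns on the left can be stripped off; after \<open>U\<close> is gone, a
  transpose brings \<open>V\<close> to the left as well.\<close>

lemma norm_diag_sandwich:
  fixes U :: "real^'r^'p" and V :: "real^'r^'q"
  assumes "transpose U ** U = mat 1" and "transpose V ** V = mat 1"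
  shows "norm (U ** diag_mat d ** transpose V) = sqrt (\<Sum>i\<in>UNIV. (d i)\<^sup>2)"
proof -
  have "norm (U ** diag_mat d ** transpose V) = norm (diag_mat d ** transpose V)"
    by (metis matrix_mul_assoc norm_matrix_mult_orthonormal_columns[OF assms(1)])
  also have "\<dots> = norm (transpose (V ** diag_mat d))"
    by (simp add: matrix_transpose_mul transpose_diag_mat)
  also have "\<dots> = norm (diag_mat d)"
    by (simp only: norm_transpose norm_matrix_mult_orthonormal_columns[OF assms(2)])
  finally show ?thesis
    by (simp add: norm_diag_mat)
qed

text \<open>The product is a weighted sum of the rank-one matrices \<open>u_k v_k^T\<close>, and the
  pairing of \<open>Q\<close> with each of these is a bilinear form in the two columns.\<close>

lemma inner_diag_sandwich:
  fixes U :: "real^'r^'p" and V :: "real^'r^'q"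
  shows "Q \<bullet> (U ** diag_mat d ** transpose V)
       = (\<Sum>k\<in>UNIV. d k * (column k U \<bullet> (Q *v column k V)))"
proof -
  have "Q \<bullet> (U ** diag_mat d ** transpose V)
      = (\<Sum>i\<in>UNIV. \<Sum>j\<in>UNIV. \<Sum>k\<in>UNIV. d k * (U $ i $ k * (Q $ i $ j * V $ j $ k)))"
    by (simp add: inner_vec_def diag_sandwich_entry sum_distrib_left mult_ac)
  also have "\<dots> = (\<Sum>k\<in>UNIV. \<Sum>i\<in>UNIV. \<Sum>j\<in>UNIV. d k * (U $ i $ k * (Q $ i $ j * V $ j $ k)))"
    by (subst (2) sum.swap, subst sum.swap) simp
  also have "\<dots> = (\<Sum>k\<in>UNIV. d k * (column k U \<bullet> (Q *v column k V)))"
    by (simp add: inner_vec_def column_def matrix_vector_mult_def sum_distrib_left)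
  finally show ?thesis .
qed

section \<open>Consequences of one fixed compact singular value decomposition\<close>

context
  fixes G :: "real^'q^'p"
    and U :: "real^'r::{finite,linorder}^'p"
    and \<sigma> :: "'r \<Rightarrow> real"
    and V :: "real^'r::{finite,linorder}^'q"
  assumes svd: "compact_svd G U \<sigma> V"
begin

lemma svd_U: "transpose U ** U = mat 1"
  and svd_V: "transpose V ** V = mat 1"
  and svd_pos: "0 < \<sigma> i"
  and svd_eq: "G = U ** diag_mat \<sigma> ** transpose V"
  using svd by (auto simp: compact_svd_def)

lemma svd_le_first: "\<sigma> i \<le> \<sigma> first_index"
  and svd_last_le: "\<sigma> last_index \<le> \<sigma> i"
  using svd by (auto simp: compact_svd_def antimono_def)

lemma svd_apply: "G *v x = U *v (diag_mat \<sigma> *v (transpose V *v x))"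
  by (subst svd_eq) (simp only: matrix_vector_mul_assoc matrix_mul_assoc)

lemma svd_apply_column: "G *v column k V = \<sigma> k *\<^sub>R column k U"
proof -
  have "diag_mat \<sigma> *v axis k 1 = \<sigma> k *\<^sub>R axis k 1"
    by (simp add: diag_mat_mult_vector vec_eq_iff axis_def)
  then show ?thesis
    unfolding column_eq_mult_axis svd_apply
    by (simp add: matrix_vector_mul_assoc[of "transpose V"] svd_V matrix_vector_mult_scaleR
        del: transpose_matrix_vector)
qed

lemma norm_svd_apply_column: "norm (G *v column k V) = \<sigma> k"
  using svd_pos[of k] by (simp add: svd_apply_column norm_column_orthonormal[OF svd_U])

lemma norm_svd: "norm G = sqrt (\<Sum>i\<in>UNIV. (\<sigma> i)\<^sup>2)"
  unfolding svd_eq by (rule norm_diag_sandwich[OF svd_U svd_V])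

lemma singular_value_le_norm: "\<sigma> i \<le> norm G"
proof -
  have "(\<sigma> i)\<^sup>2 \<le> (\<Sum>i\<in>UNIV. (\<sigma> i)\<^sup>2)"
    by (rule member_le_sum) auto
  then show ?thesis
    unfolding norm_svd by (rule real_le_rsqrt)
qed

lemma norm_svd_pos: "0 < norm G"
  using singular_value_le_norm svd_pos by (rule less_le_trans[rotated])

text \<open>Upper bound: \<open>transpose V\<close> contracts, the diagonal factor stretches by at
  most the largest singular value, and \<open>U\<close> is an isometry. The first column of
  \<open>V\<close> attains it.\<close>

lemma onorm_svd: "onorm ((*v) G) = \<sigma> first_index"
proof (rule antisym)
  show "onorm ((*v) G) \<le> \<sigma> first_index"
  proof (rule onorm_le)
    fix x
    have "norm (G *v x) = norm (diag_mat \<sigma> *v (transpose V *v x))"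
      by (simp add: svd_apply norm_orthonormal_columns[OF svd_U])
    also have "\<dots> \<le> norm (\<sigma> first_index *\<^sub>R (transpose V *v x))"
      by (rule norm_le_componentwise_cart)
         (use svd_le_first svd_pos in
           \<open>auto simp: diag_mat_mult_vector abs_mult less_imp_le intro!: mult_right_mono\<close>)
    also have "\<dots> \<le> \<sigma> first_index * norm x"
      using norm_transpose_orthonormal_columns_le[OF svd_V] svd_pos[of first_index] by simp
    finally show "norm (G *v x) \<le> \<sigma> first_index * norm x" .
  qed
  show "\<sigma> first_index \<le> onorm ((*v) G)"
    using onorm[OF matrix_vector_mul_bounded_linear[of G], of "column first_index V"]
    by (simp add: norm_svd_apply_column norm_column_orthonormal[OF svd_V])
qed

text \<open>\<open>G\<close> may have a kernel, so the smallest singular value only controls the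
  component of \<open>x\<close> in the row space, whose length is
  \<open>norm (transpose V *v x)\<close>.\<close>

lemma svd_last_lower_bound: "\<sigma> last_index * norm (transpose V *v x) \<le> norm (G *v x)"
proof -
  have "norm (\<sigma> last_index *\<^sub>R (transpose V *v x)) \<le> norm (diag_mat \<sigma> *v (transpose V *v x))"
    by (rule norm_le_componentwise_cart)
       (use svd_last_le svd_pos in
         \<open>auto simp: diag_mat_mult_vector abs_mult less_imp_le intro!: mult_right_mono\<close>)
  then show ?thesis
    using svd_pos[of last_index] by (simp add: svd_apply norm_orthonormal_columns[OF svd_U])
qed

lemma polar_mult_column: "(U ** transpose V) *v column k V = column k U"
  unfolding column_eq_mult_axis
  by (simp add: matrix_vector_mul_assoc matrix_mul_assoc[symmetric] svd_V)

lemma norm_polar_le: "norm ((U ** transpose V) *v x) \<le> norm x"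
  by (simp add: matrix_vector_mul_assoc[symmetric] norm_orthonormal_columns[OF svd_U]
      norm_transpose_orthonormal_columns_le[OF svd_V] del: transpose_matrix_vector)

lemma inner_polar: "(U ** transpose V) \<bullet> G = (\<Sum>k\<in>UNIV. \<sigma> k)"
  by (subst svd_eq) (simp add: inner_diag_sandwich polar_mult_column dot_square_norm
      norm_column_orthonormal[OF svd_U])

lemma inner_contraction_summand_le:
  assumes "\<And>x. norm (Q *v x) \<le> norm x"
  shows "\<sigma> k * (column k U \<bullet> (Q *v column k V)) \<le> \<sigma> k"
proof -
  have "column k U \<bullet> (Q *v column k V) \<le> norm (column k U) * norm (Q *v column k V)"
    by (rule norm_cauchy_schwarz)
  also have "\<dots> \<le> 1"
    using assms[of "column k V"]
    by (simp add: norm_column_orthonormal[OF svd_U] norm_column_orthonormal[OF svd_V])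
  finally show ?thesis
    using svd_pos[of k] by simp
qed

text \<open>The extremal property behind uniqueness: no contraction pairs with \<open>G\<close> to
  more than the sum of the singular values, which \<open>inner_polar\<close> shows to be
  attained.\<close>

lemma inner_contraction_le:
  assumes "\<And>x. norm (Q *v x) \<le> norm x"
  shows "Q \<bullet> G \<le> (\<Sum>k\<in>UNIV. \<sigma> k)"
proof -
  have "Q \<bullet> G = (\<Sum>k\<in>UNIV. \<sigma> k * (column k U \<bullet> (Q *v column k V)))"
    by (subst svd_eq) (rule inner_diag_sandwich)
  also have "\<dots> \<le> (\<Sum>k\<in>UNIV. \<sigma> k)"
    by (rule sum_mono, rule inner_contraction_summand_le, rule assms)
  finally show ?thesis .
qed

lemma contraction_maximal_column:
  assumes contr: "\<And>x. norm (Q *v x) \<le> norm x"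
    and max: "Q \<bullet> G = (\<Sum>k\<in>UNIV. \<sigma> k)"
  shows "Q *v column k V = column k U"
proof -
  let ?u = "column k U" and ?w = "Q *v column k V"
  have "(\<Sum>k\<in>UNIV. \<sigma> k * (column k U \<bullet> (Q *v column k V))) = (\<Sum>k\<in>UNIV. \<sigma> k)"
    using max by (subst (asm) svd_eq) (simp add: inner_diag_sandwich)
  \<comment> \<open>Each summand is at most \<open>\<sigma> k\<close>, so equality of the sums
    forces equality in every term.\<close>
  then have "\<sigma> k * (?u \<bullet> ?w) = \<sigma> k"
    using sum_mono_inv[of "\<lambda>k. \<sigma> k * (column k U \<bullet> (Q *v column k V))" UNIV \<sigma> k]
      inner_contraction_summand_le[OF contr] by auto
  then have uw: "?u \<bullet> ?w = 1"
    using svd_pos[of k] by simp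
  have "(norm ?w)\<^sup>2 \<le> 1"
    using contr[of "column k V"] by (simp add: norm_column_orthonormal[OF svd_V] power_le_one)
  \<comment> \<open>The equality case of Cauchy--Schwarz by expansion: the right side is at most
    \<open>1 + 1 - 2\<close>.\<close>
  moreover have "(norm (?w - ?u))\<^sup>2 = (norm ?w)\<^sup>2 + (norm ?u)\<^sup>2 - 2 * (?u \<bullet> ?w)"
    by (simp add: power2_norm_eq_inner inner_diff inner_commute)
  ultimately have "(norm (?w - ?u))\<^sup>2 \<le> 0"
    by (simp add: uw norm_column_orthonormal[OF svd_U])
  then show ?thesis
    by simp
qed

text \<open>\<open>V ** transpose V\<close> is the orthogonal projection onto the row space of
  \<open>G\<close>.\<close>

lemma row_space_projection: "G ** V ** transpose V = G"
  by (simp add: svd_eq matrix_mul_assoc[symmetric] svd_V)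

end

section \<open>Independence of the polar factor and condition number from the decomposition\<close>

text \<open>The rows of \<open>transpose V'\<close> are combinations of rows of \<open>G\<close>,
  because the positive diagonal factor can be inverted; the projection built from \<open>V\<close>
  therefore fixes them.\<close>

lemma row_space_projection_other:
  fixes G :: "real^'q^'p" and U U' :: "real^'r::{finite,linorder}^'p"
    and V V' :: "real^'r::{finite,linorder}^'q"
  assumes svd: "compact_svd G U \<sigma> V" and svd': "compact_svd G U' \<sigma>' V'"
  shows "transpose V' ** V ** transpose V = transpose V'"
proof -
  let ?D = "diag_mat (\<lambda>i. inverse (\<sigma>' i))"
  have "?D ** diag_mat \<sigma>' = mat 1"
    using svd_pos[OF svd'] by (simp add: diag_mat_mult less_imp_neq[symmetric] diag_mat_1)
  then have *: "transpose V' = ?D ** transpose U' ** G"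
    by (subst svd_eq[OF svd'])
       (metis matrix_mul_assoc matrix_mul_lid svd_U[OF svd'])
  show ?thesis
    unfolding * using row_space_projection[OF svd] by (metis matrix_mul_assoc)
qed

lemma polar_unique:
  fixes G :: "real^'q^'p" and U U' :: "real^'r::{finite,linorder}^'p"
    and V V' :: "real^'r::{finite,linorder}^'q"
  assumes svd: "compact_svd G U \<sigma> V" and svd': "compact_svd G U' \<sigma>' V'"
  shows "U' ** transpose V' = U ** transpose V"
proof -
  let ?Q = "U' ** transpose V'"
  \<comment> \<open>Each polar factor is a contraction, so the extremal bound of either
    decomposition applies to the polar factor of the other, and the two sums of singular values
    agree.\<close>
  have "?Q \<bullet> G = (\<Sum>k\<in>UNIV. \<sigma> k)"
    using inner_contraction_le[OF svd norm_polar_le[OF svd']] inner_polar[OF svd']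
      inner_contraction_le[OF svd' norm_polar_le[OF svd]] inner_polar[OF svd] by simp
  then have "?Q *v column k V = column k U" for k
    by (rule contraction_maximal_column[OF svd norm_polar_le[OF svd']])
  then have "(?Q ** V) *v axis k 1 = U *v axis k 1" for k
    by (simp only: column_eq_mult_axis matrix_vector_mul_assoc)
  then have "column k (?Q ** V) = column k U" for k
    by (simp add: matrix_vector_mult_basis)
  then have QV: "?Q ** V = U"
    by (simp add: column_def vec_eq_iff)
  \<comment> \<open>Agreement on the columns of \<open>V\<close> suffices, since \<open>?Q\<close>
    is unchanged by projecting onto their span first.\<close>
  have "?Q = U' ** (transpose V' ** V ** transpose V)"
    by (simp only: row_space_projection_other[OF svd svd'])
  also have "\<dots> = U ** transpose V"
    by (metis QV matrix_mul_assoc)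
  finally show ?thesis .
qed

lemma Orth_eq:
  fixes U :: "real^'r::{finite,linorder}^'p"
  assumes "compact_svd G U \<sigma> V"
  shows "Orth TYPE('r) G = U ** transpose V"
  unfolding Orth_def by (rule the_equality) (use assms polar_unique in blast)+

text \<open>The last column of \<open>V'\<close> is a unit vector in the row space, so
  \<open>transpose V\<close> preserves its length, while \<open>G\<close> maps it to a vector of
  length \<open>\<sigma>' last_index\<close>. The lower bound from the other decomposition then
  applies.\<close>

lemma svd_last_le_other:
  fixes G :: "real^'q^'p" and U U' :: "real^'r::{finite,linorder}^'p"
    and V V' :: "real^'r::{finite,linorder}^'q"
  assumes svd: "compact_svd G U \<sigma> V" and svd': "compact_svd G U' \<sigma>' V'"
  shows "\<sigma> last_index \<le> \<sigma>' last_index"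
proof -
  let ?x = "column last_index V'"
  have "transpose (transpose V' ** V ** transpose V) = transpose (transpose V')"
    by (simp only: row_space_projection_other[OF svd svd'])
  then have "V ** transpose V ** V' = V'"
    by (simp add: matrix_transpose_mul matrix_mul_assoc)
  then have "V *v (transpose V *v ?x) = ?x"
    unfolding column_eq_mult_axis matrix_vector_mul_assoc by (simp only: matrix_mul_assoc)
  then have "norm (transpose V *v ?x) = 1"
    by (metis norm_orthonormal_columns[OF svd_V[OF svd]]
        norm_column_orthonormal[OF svd_V[OF svd']])
  then show ?thesis
    using svd_last_lower_bound[OF svd, of ?x] by (simp add: norm_svd_apply_column[OF svd'])
qed

text \<open>The largest singular value is the operator norm of \<open>G\<close>; the smallest is
  determined by applying the preceding comparison in both directions.\<close>

lemma condition_number_eq: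
  fixes \<sigma> :: "'r::{finite,linorder} \<Rightarrow> real"
  assumes svd: "compact_svd G U \<sigma> V"
  shows "condition_number TYPE('r) G = \<sigma> first_index / \<sigma> last_index"
proof -
  have "\<sigma>' first_index / \<sigma>' last_index = \<sigma> first_index / \<sigma> last_index"
    if svd': "compact_svd G U' \<sigma>' V'" for U' V' and \<sigma>' :: "'r \<Rightarrow> real"
    using onorm_svd[OF svd] onorm_svd[OF svd'] svd_last_le_other[OF svd svd']
      svd_last_le_other[OF svd' svd] by simp
  then show ?thesis
    unfolding condition_number_def by (intro the_equality) (use svd in blast)+
qed

text \<open>The largest singular value cancels. What remains is the reciprocal of the initial
  normalized singular value, which ties both the lower bound and the exit times to the stable
  rank.\<close>

lemma kappa_stable_rank:
  assumes "compact_svd G U \<sigma> V"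
  shows "kappa \<sigma> i * sqrt (stable_rank G) = norm G / \<sigma> i"
  using svd_pos[OF assms, of first_index]
  by (simp add: kappa_def stable_rank_def onorm_svd[OF assms] real_sqrt_divide)

section \<open>The iteration and its action on singular values\<close>

lemma matrix_add_rdistrib: "(A + B) ** C = A ** C + B ** (C :: real^'k^'n)"
  by (simp add: vec_eq_iff matrix_matrix_mult_def sum.distrib distrib_right)

lemma matrix_scaleR_mult: "(r *\<^sub>R A) ** B = r *\<^sub>R (A ** (B :: real^'k^'n))"
  by (simp add: vec_eq_iff matrix_matrix_mult_def sum_distrib_left mult_ac)

lemma iterate_diag_step:
  fixes U :: "real^'r^'p" and V :: "real^'r^'q"
  assumes U: "transpose U ** U = mat 1" and V: "transpose V ** V = mat 1"
    and X: "X = U ** diag_mat d ** transpose V" and S: "S = X ** transpose X"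
  shows "(a *\<^sub>R mat 1 + b *\<^sub>R S + c *\<^sub>R (S ** S)) ** X
       = U ** diag_mat (\<lambda>i. phi a b c (d i)) ** transpose V"
proof -
  \<comment> \<open>Stated for arbitrary \<open>e\<close> so that it can be applied twice, giving
    the cubic term and then the quintic one.\<close>
  have S_mult: "S ** (U ** diag_mat e ** transpose V)
      = U ** diag_mat (\<lambda>i. (d i)\<^sup>2 * e i) ** transpose V" for e
  proof -
    have "S ** (U ** diag_mat e ** transpose V) = U ** diag_mat d ** (transpose V ** V)
        ** diag_mat d ** (transpose U ** U) ** diag_mat e ** transpose V"
      by (simp only: S X matrix_transpose_mul transpose_transpose transpose_diag_mat
          matrix_mul_assoc)
    also have "\<dots> = U ** (diag_mat d ** diag_mat d ** diag_mat e) ** transpose V"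
      by (simp only: U V matrix_mul_rid matrix_mul_assoc)
    finally show ?thesis
      by (simp add: diag_mat_mult power2_eq_square)
  qed
  have "(a *\<^sub>R mat 1 + b *\<^sub>R S + c *\<^sub>R (S ** S)) ** X
      = a *\<^sub>R X + b *\<^sub>R (S ** X) + c *\<^sub>R (S ** (S ** X))"
    by (simp add: matrix_add_rdistrib matrix_scaleR_mult matrix_mul_assoc)
  also have "\<dots> = U ** diag_mat (\<lambda>i. phi a b c (d i)) ** transpose V"
    unfolding X S_mult
    by (simp add: vec_eq_iff diag_sandwich_entry phi_def sum_distrib_left sum.distrib[symmetric]
        algebra_simps numeral_eq_Suc)
  finally show ?thesis .
qed

lemma phi_eq_mult_pi_poly: "phi a b c s = s * pi_poly a b c (s\<^sup>2)"
  by (simp add: phi_def pi_poly_def algebra_simps numeral_eq_Suc)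

text \<open>As long as the linear majorant \<open>a ^ k * s 0\<close> has not passed 1, all iterates
  so far lie in \<open>[0,1]\<close>, where each step multiplies by a positive factor of at most
  \<open>a\<close>.\<close>

lemma phi_iterate_bounds:
  assumes a: "1 < a" and pi: "\<forall>t\<in>{0..1}. 0 < pi_poly a b c t \<and> pi_poly a b c t \<le> a"
    and nonneg: "0 \<le> s 0" and step: "\<And>k. s (Suc k) = phi a b c (s k)"
    and small: "a ^ k * s 0 \<le> 1"
  shows "0 \<le> s k \<and> s k \<le> a ^ k * s 0"
  using small
proof (induction k)
  case 0
  then show ?case using nonneg by simp
next
  case (Suc k)
  \<comment> \<open>The majorant grows with \<open>k\<close>, so the smallness assumed at
    \<open>Suc k\<close> is inherited at \<open>k\<close> and releases the induction
    hypothesis.\<close>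
  have "a ^ k * s 0 \<le> a ^ Suc k * s 0"
    using a nonneg by (simp add: mult_right_mono)
  with Suc have IH: "0 \<le> s k" "s k \<le> a ^ k * s 0" and "s k \<le> 1"
    by auto
  then have "(s k)\<^sup>2 \<in> {0..1}"
    by (simp add: power_le_one)
  with pi have "0 < pi_poly a b c ((s k)\<^sup>2)" "pi_poly a b c ((s k)\<^sup>2) \<le> a"
    by auto
  then have "0 \<le> s (Suc k)" "s (Suc k) \<le> s k * a"
    using IH(1) by (auto simp: step phi_eq_mult_pi_poly intro: mult_left_mono)
  moreover have "s k * a \<le> a ^ Suc k * s 0"
    using mult_right_mono[OF IH(2), of a] a by (simp add: mult_ac)
  ultimately show ?case
    by simp
qed

theorem theorem3p1:
  fixes G :: "real^'q^'p"
    and U :: "real^'r::{finite,linorder}^'p"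
    and \<sigma> :: "'r \<Rightarrow> real"
    and V :: "real^'r::{finite,linorder}^'q"
    and a b c :: real
  assumes "CARD('p) \<le> CARD('q)"
    and "compact_svd G U \<sigma> V"
    and "a > 1"
    and "\<forall>t\<in>{0..1}. 0 < pi_poly a b c t \<and> pi_poly a b c t \<le> a"
  shows "(\<exists>s :: nat \<Rightarrow> 'r \<Rightarrow> real.
            (\<forall>i. s 0 i = \<sigma> i / norm G) \<and>
            (\<forall>k i. s (Suc k) i = phi a b c (s k i)) \<and>
            (\<forall>k. iterate a b c G k = U ** diag_mat (s k) ** transpose V))
       \<and> (\<forall>k. 1 / sqrt (real CARD('r)) * norm (iterate a b c G k - Orth TYPE('r) G)
            \<ge> 1 / sqrt (real CARD('r)) *
              sqrt (\<Sum>i\<in>UNIV. (max (1 - a ^ k / (kappa \<sigma> i * sqrt (stable_rank G))) 0)\<^sup>2))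
       \<and> (\<forall>i. (\<forall>x::real. a powr x * \<sigma> i / norm G = 1 \<longleftrightarrow> x = exit_time a G \<sigma> i) \<and>
              exit_time a G \<sigma> i = log a (kappa \<sigma> i * sqrt (stable_rank G)))
       \<and> exit_time a G \<sigma> first_index = log a (sqrt (stable_rank G))
       \<and> exit_time a G \<sigma> last_index = log a (condition_number TYPE('r) G * sqrt (stable_rank G))
       \<and> exit_time a G \<sigma> last_index - exit_time a G \<sigma> first_index
           = log a (condition_number TYPE('r) G)"
proof -
  note svd = assms(2) and a = assms(3) and pi = assms(4)
  note U = svd_U[OF svd] and V = svd_V[OF svd]
  have G0: "0 < norm G" and \<sigma>0: "\<And>i. 0 < \<sigma> i"
    using norm_svd_pos[OF svd] svd_pos[OF svd] by auto
  define s where "s k = ((\<lambda>x i. phi a b c (x i)) ^^ k) (\<lambda>i. \<sigma> i / norm G)" for k :: nat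
  have s0: "s 0 i = \<sigma> i / norm G" and sS: "s (Suc k) i = phi a b c (s k i)" for k i
    by (simp_all add: s_def)
  have it: "iterate a b c G k = U ** diag_mat (s k) ** transpose V" for k
  proof (induction k)
    case 0
    have "(1 / norm G) *\<^sub>R (U ** diag_mat \<sigma> ** transpose V)
        = U ** diag_mat (\<lambda>i. \<sigma> i / norm G) ** transpose V"
      by (simp add: vec_eq_iff diag_sandwich_entry sum_divide_distrib)
    then show ?case
      by (simp add: s_def flip: svd_eq[OF svd])
  next
    case (Suc k)
    show ?case
      using iterate_diag_step[OF U V Suc refl, of a b c] by (simp add: Let_def s_def)
  qed
  have bound: "norm (iterate a b c G k - Orth TYPE('r) G)
      \<ge> sqrt (\<Sum>i\<in>UNIV. (max (1 - a ^ k / (kappa \<sigma> i * sqrt (stable_rank G))) 0)\<^sup>2)" for k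
  proof -
    \<comment> \<open>The polar factor has the same outer factors with all diagonal entries 1, so
      the difference is again a diagonal sandwich.\<close>
    have "iterate a b c G k - Orth TYPE('r) G
        = U ** diag_mat (s k) ** transpose V - U ** diag_mat (\<lambda>i. 1) ** transpose V"
      by (simp add: it Orth_eq[OF svd] diag_mat_1)
    also have "\<dots> = U ** diag_mat (\<lambda>i. s k i - 1) ** transpose V"
      by (simp add: vec_eq_iff diag_sandwich_entry algebra_simps sum_subtractf)
    finally have "norm (iterate a b c G k - Orth TYPE('r) G) = sqrt (\<Sum>i\<in>UNIV. (s k i - 1)\<^sup>2)"
      by (simp add: norm_diag_sandwich[OF U V])
    moreover have "(max (1 - a ^ k / (kappa \<sigma> i * sqrt (stable_rank G))) 0)\<^sup>2 \<le> (s k i - 1)\<^sup>2" for i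
    \<comment> \<open>This condition says that the truncation is inactive. Then
      \<open>s k i \<le> a ^ k * s 0 i \<le> 1\<close>, so the distance of \<open>s k i\<close> from
      1 is at least that of the majorant.\<close>
    proof (cases "a ^ k * s 0 i \<le> 1")
      case True
      have "s k i \<le> a ^ k * s 0 i"
        using phi_iterate_bounds[OF a pi, of "\<lambda>k. s k i" k] True sS \<sigma>0[of i] G0
        by (simp add: s0)
      with True have "\<bar>1 - a ^ k * s 0 i\<bar> \<le> \<bar>s k i - 1\<bar>"
        by simp
      then have "(1 - a ^ k * s 0 i)\<^sup>2 \<le> (s k i - 1)\<^sup>2"
        by (simp only: abs_le_square_iff)
      with True show ?thesis
        by (simp add: kappa_stable_rank[OF svd] s0)
    next
      \<comment> \<open>The truncated term is zero here, and every square bounds it from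
        above.\<close>
      case False
      then show ?thesis
        by (simp add: kappa_stable_rank[OF svd] s0)
    qed
    ultimately show ?thesis
      by (simp add: sum_mono)
  qed
  have exit: "exit_time a G \<sigma> i = log a (kappa \<sigma> i * sqrt (stable_rank G))" for i
    by (simp add: kappa_stable_rank[OF svd] exit_time_def)
  have "a powr x * \<sigma> i / norm G = 1 \<longleftrightarrow> x = exit_time a G \<sigma> i" for x i
  proof -
    have "a powr x * \<sigma> i / norm G = 1 \<longleftrightarrow> a powr x = norm G / \<sigma> i"
      using G0 \<sigma>0[of i] by (auto simp: field_simps)
    also have "\<dots> \<longleftrightarrow> x = log a (norm G / \<sigma> i)"
      using a divide_pos_pos[OF G0 \<sigma>0[of i]]
      by (metis less_irrefl less_trans log_powr_cancel powr_log_cancel zero_less_one)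
    finally show ?thesis
      by (simp add: exit_time_def)
  qed
  moreover have "exit_time a G \<sigma> first_index = log a (sqrt (stable_rank G))"
    using \<sigma>0[of first_index] by (simp add: exit kappa_def)
  moreover have "exit_time a G \<sigma> last_index
      = log a (condition_number TYPE('r) G * sqrt (stable_rank G))"
    by (simp add: exit kappa_def condition_number_eq[OF svd])
  moreover have "exit_time a G \<sigma> last_index - exit_time a G \<sigma> first_index
      = log a (condition_number TYPE('r) G)"
    using a G0 \<sigma>0[of first_index] \<sigma>0[of last_index]
    by (simp add: exit_time_def condition_number_eq[OF svd] log_divide)
  moreover have "1 / sqrt (real CARD('r)) * norm (iterate a b c G k - Orth TYPE('r) G)
      \<ge> 1 / sqrt (real CARD('r)) *
        sqrt (\<Sum>i\<in>UNIV. (max (1 - a ^ k / (kappa \<sigma> i * sqrt (stable_rank G))) 0)\<^sup>2)" for k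
    by (rule mult_left_mono[OF bound]) simp
  ultimately show ?thesis
    using s0 sS it exit by blast
qed

end
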